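(* Let $n\ge 5$. The algorithm "PDC uniform sampling from $LS_n$" (described in the context) samples uniformly over the set $LS_n$ of all Latin squares of order $n$. The number of times to sample rows $R_2,\dots,R_{n-3}$ is geometrically distributed with expected value $$E_n:=\frac{\lfloor 6^{n/3}2^{n/2}\rfloor\,\left([n!/e]\right)^{n-4}}{|LS_n|/n!},\qquad n\ge 5.$$
   Context: A Latin square of order $n$ is an $n\times n$ matrix in which each row $R_1,\dots,R_n$ and each column $C_1,\dots,C_n$ is a permutation of $\{1,\dots,n\}$; $LS_n$ is the set of all Latin squares of order $n$. $[x]$ denotes the integer closest to $x$ and $\lfloor x\rfloor$ the floor of $x$. Algorithm "PDC uniform sampling from $LS_n$": 1. Let $R_1=(1,\dots,n)$. 2. For $i=2,\dots,n-3$, generate $R_i$ uniformly (independently) from the set of fixed-point free permutations of $\{1,\dots,n\}$. 3. Let $d$ denote the number of possible completions to a Latin square of order $n$ given $(R_1,\dots,R_{n-3})$. 4. Generate $U$ uniform on $(0,1)$, independent of everything else. If $U<d/\lfloor 6^{n/3}2^{n/2}\rfloor$, select one of the $d$ completions uniformly at random; otherwise go to step 2. 5. Apply a (uniformly) random permutation to the rows of the matrix. 6. Apply a (uniformly) random permutation of $\{1,\dots,n\}$ to the entries and return the matrix. The number of times to sample rows $R_2,\dots,R_{n-3}$ is the number of executions of step 2. *)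

theory Defs
  imports "HOL-Probability.Probability" "HOL-Combinatorics.Permutations"
begin

text \<open>
  A matrix is represented by its rows: \<open>L i j\<close> is the entry in row \<open>i\<close> and column \<open>j\<close>, with
  \<open>i, j \<in> {1..n}\<close>. Each row of a Latin square is a permutation of \<open>{1..n}\<close> in the sense of
  \<open>permutes\<close>. To have one function per matrix, rows with index outside \<open>{1..n}\<close> are
  \<open>undefined\<close>; for columns this normalization is part of \<open>permutes\<close>.
\<close>

definition latin_squares :: "nat \<Rightarrow> (nat \<Rightarrow> nat \<Rightarrow> nat) set" where
  "latin_squares n =
     {L \<in> {1..n} \<rightarrow>\<^sub>E {\<pi>. \<pi> permutes {1..n}}.
        \<forall>j\<in>{1..n}. bij_betw (\<lambda>i. L i j) {1..n} {1..n}}"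

definition derangements :: "nat \<Rightarrow> (nat \<Rightarrow> nat) set" where
  "derangements n = {\<pi>. \<pi> permutes {1..n} \<and> (\<forall>j\<in>{1..n}. \<pi> j \<noteq> j)}"

definition completions :: "nat \<Rightarrow> (nat \<Rightarrow> nat \<Rightarrow> nat) \<Rightarrow> (nat \<Rightarrow> nat \<Rightarrow> nat) set" where
  "completions n R = {L \<in> latin_squares n. \<forall>i\<in>{1..n-3}. L i = R i}"

definition completion_bound :: "nat \<Rightarrow> int" where
  "completion_bound n = \<lfloor>6 powr (real n / 3) * 2 powr (real n / 2)\<rfloor>"

text \<open>
  The truth value of \<open>U < q\<close> for a fresh \<open>U\<close> that is uniform on \<open>(0,1)\<close>. It has to be
  a \<open>pmf\<close>, since \<open>spmf\<close> programs cannot sample from a continuous distribution directly.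
\<close>

definition uniform_less :: "real \<Rightarrow> bool pmf" where
  "uniform_less q =
     Abs_pmf (distr (uniform_measure lborel {0<..<1}) (count_space UNIV) (\<lambda>U. U < q))"

lemma measure_pmf_uniform_less:
  "measure_pmf (uniform_less q) =
     distr (uniform_measure lborel {0<..<1}) (count_space UNIV) (\<lambda>U. U < q)"
proof -
  let ?U = "uniform_measure lborel {0<..<1::real}"
  let ?D = "distr ?U (count_space UNIV) (\<lambda>U. U < q)"
  interpret U: prob_space ?U
    by (rule prob_space_uniform_measure) auto
  have [measurable]: "(\<lambda>U. U < q) \<in> measurable ?U (count_space UNIV)"
    by measurable
  interpret D: prob_space ?D
    by (rule U.prob_space_distr) measurable
  have "AE x in ?D. measure ?D {x} \<noteq> 0"
    by (subst D.AE_support_countable) (auto intro!: exI[of _ UNIV])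
  then show ?thesis
    unfolding uniform_less_def
    by (intro Abs_pmf_inverse) (simp add: D.prob_space_axioms)
qed

text \<open>
  The rejection loop; \<open>R 1 = id\<close> is the row \<open>(1,\<dots>,n)\<close>. It returns the number of executions of
  the step that samples \<open>R\<^sub>2, \<dots>, R\<^sub>n\<^sub>-\<^sub>3\<close> together with the selected completion. Statements
  in sequence sample independently; mass lost by an \<open>spmf\<close> is the probability of divergence.
\<close>

partial_function (spmf) pdc_loop :: "nat \<Rightarrow> (nat \<times> (nat \<Rightarrow> nat \<Rightarrow> nat)) spmf" where
  "pdc_loop n = do {
     S \<leftarrow> spmf_of_pmf (Pi_pmf {2..n-3} undefined (\<lambda>_. pmf_of_set (derangements n)));
     let R = S(1 := id);
     let d = card (completions n R);
     accept \<leftarrow> spmf_of_pmf (uniform_less (real d / real_of_int (completion_bound n)));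
     if accept then do {
       L \<leftarrow> spmf_of_set (completions n R);
       return_spmf (1, L)
     } else do {
       (t, L) \<leftarrow> pdc_loop n;
       return_spmf (Suc t, L)
     }
   }"

definition pdc_sampling :: "nat \<Rightarrow> (nat \<times> (nat \<Rightarrow> nat \<Rightarrow> nat)) spmf" where
  "pdc_sampling n = do {
     (t, L) \<leftarrow> pdc_loop n;
     \<rho> \<leftarrow> spmf_of_set {\<rho>. \<rho> permutes {1..n}};
     \<sigma> \<leftarrow> spmf_of_set {\<sigma>. \<sigma> permutes {1..n}};
     return_spmf (t, \<lambda>i\<in>{1..n}. \<lambda>j. \<sigma> (L (\<rho> i) j))
   }"

text \<open>
  The library's \<open>geometric_pmf p\<close> counts the failures before the first success, hence the
  shift by \<open>Suc\<close> to count trials.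
\<close>

definition geometric_trials_pmf :: "real \<Rightarrow> nat pmf" where
  "geometric_trials_pmf p = map_pmf Suc (geometric_pmf p)"

end

theory Submission
  imports Defs
begin

text \<open>
  Every normalized Latin square (first row \<open>id\<close>) is a completion of exactly one choice of
  rows \<open>R\<^sub>2, \<dots>, R\<^sub>n\<^sub>-\<^sub>3\<close>. A choice with \<open>d\<close> completions is accepted with probability \<open>d / B\<close> and each
  completion is then selected with probability \<open>1 / d\<close>, so one round returns each normalized square
  with the same probability, and the number of rounds is geometric and independent of the result.
  This needs \<open>d \<le> B\<close>, as otherwise the acceptance probability is clipped at \<open>1\<close>: the row \<open>n - 2\<close> is
  a perfect matching in a \<open>3\<close>-regular bipartite graph, the row \<open>n - 1\<close> then one in a
  \<open>2\<close>-regular graph, and Bregman's inequality bounds their numbers by \<open>6\<^bsup>n/3\<^esup>\<close> and \<open>2\<^bsup>n/2\<^esup>\<close>.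
  Finally, for each fixed row permutation, relabelling the entries maps pairs of a normalized square
  and a permutation bijectively to Latin squares.
\<close>

section \<open>Bregman's inequality\<close>

text \<open>Systems of distinct representatives. When all \<open>A i\<close> lie in a set of size
  \<open>card I\<close>, these are the perfect matchings of a bipartite graph, and their number is
  the permanent of its 0-1 matrix. \<open>PiE\<close> gives one function per matching.\<close>

definition matchings :: "'a set \<Rightarrow> ('a \<Rightarrow> 'b set) \<Rightarrow> ('a \<Rightarrow> 'b) set" where
  "matchings I A = {f \<in> PiE I A. inj_on f I}"

lemma finite_matchings:
  assumes "finite I" "\<And>i. i \<in> I \<Longrightarrow> finite (A i)"
  shows "finite (matchings I A)"
  using finite_PiE[of I A] assms by (simp add: matchings_def)

text \<open>One term of the expansion of the permanent along row \<open>i\<close>: deleting row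
  \<open>i\<close> and column \<open>k\<close> leaves the minor to which the induction for Bregman's
  inequality applies.\<close>

lemma card_matchings_fixing:
  assumes i: "i \<in> I" and k: "k \<in> A i"
  shows "card {f \<in> matchings I A. f i = k} = card (matchings (I - {i}) (\<lambda>j. A j - {k}))"
proof -
  have "bij_betw (\<lambda>f. restrict f (I - {i})) {f \<in> matchings I A. f i = k}
          (matchings (I - {i}) (\<lambda>j. A j - {k}))"
  proof (rule bij_betw_byWitness[where f' = "\<lambda>g. g(i := k)"])
    show "\<forall>f\<in>{f \<in> matchings I A. f i = k}. (restrict f (I - {i}))(i := k) = f"
      using i by (auto simp: matchings_def fun_eq_iff PiE_def extensional_def)
    show "\<forall>g\<in>matchings (I - {i}) (\<lambda>j. A j - {k}). restrict (g(i := k)) (I - {i}) = g"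
      by (auto simp: matchings_def fun_eq_iff PiE_def extensional_def)
    show "(\<lambda>f. restrict f (I - {i})) ` {f \<in> matchings I A. f i = k}
            \<subseteq> matchings (I - {i}) (\<lambda>j. A j - {k})"
      using i by (auto simp: matchings_def inj_on_def PiE_def Pi_def)
    show "(\<lambda>g. g(i := k)) ` matchings (I - {i}) (\<lambda>j. A j - {k})
            \<subseteq> {f \<in> matchings I A. f i = k}"
    proof clarify
      fix g assume g: "g \<in> matchings (I - {i}) (\<lambda>j. A j - {k})"
      have "g(i := k) \<in> PiE I A"
        using g i k by (auto simp: matchings_def PiE_def Pi_def extensional_def)
      moreover have "inj_on (g(i := k)) I"
        using g unfolding matchings_def inj_on_def PiE_def Pi_def by auto
      ultimately show "g(i := k) \<in> matchings I A \<and> (g(i := k)) i = k"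
        by (simp add: matchings_def)
    qed
  qed
  then show ?thesis by (rule bij_betw_same_card)
qed

text \<open>A uniform random matching has entropy \<open>ln N\<close>; its value at \<open>i\<close> has entropy at most \<open>ln (card (A i))\<close>.\<close>

lemma matching_entropy_le:
  fixes I :: "'a set" and A :: "'a \<Rightarrow> 'b set"
  assumes fin: "finite (matchings I A)" and i: "i \<in> I" and Ai: "finite (A i)"
  shows "real (card (matchings I A)) * ln (card (matchings I A)) \<le>
    real (card (matchings I A)) * ln (card (A i)) +
    (\<Sum>f\<in>matchings I A. ln (card {g \<in> matchings I A. g i = f i}))"
proof (cases "matchings I A = {}")
  case False
  let ?M = "matchings I A" and ?r = "real (card (A i))"
  define N where "N k = card {g \<in> ?M. g i = k}" for k
  have Mi: "f i \<in> A i" if "f \<in> ?M" for f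
    using that i by (auto simp: matchings_def)
  have cM: "0 < card ?M" using False fin by (simp add: card_gt_0_iff)
  have r: "0 < ?r" using False Mi Ai by (auto simp: card_gt_0_iff)
  have Npos: "0 < N (f i)" if "f \<in> ?M" for f
    using that fin unfolding N_def by (subst card_gt_0_iff) auto
  \<comment> \<open>Grouped by the value at \<open>i\<close>, each fibre contributes 1, so the sum
    counts the values attained, which are at most \<open>card (A i)\<close>.\<close>
  have "(\<Sum>f\<in>?M. 1 / real (N (f i))) = (\<Sum>k\<in>(\<lambda>f. f i) ` ?M. \<Sum>f\<in>{g\<in>?M. g i = k}. 1 / real (N (f i)))"
    using fin by (rule sum.image_gen)
  also have "\<dots> = (\<Sum>k\<in>(\<lambda>f. f i) ` ?M. 1)"
  proof (rule sum.cong)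
    fix k assume "k \<in> (\<lambda>f. f i) ` ?M"
    then have "0 < N k" using Npos by auto
    then show "(\<Sum>f\<in>{g\<in>?M. g i = k}. 1 / real (N (f i))) = 1"
      by (simp add: N_def)
  qed simp
  also have "\<dots> \<le> ?r"
    using Mi Ai by (auto intro!: card_mono)
  finally have *: "(\<Sum>f\<in>?M. 1 / real (N (f i))) \<le> ?r" .
  have "0 \<le> card ?M - card ?M / ?r * (\<Sum>f\<in>?M. 1 / real (N (f i)))"
    using * r by (simp add: field_simps) (metis mult.commute mult_left_mono of_nat_0_le_iff)
  also have "\<dots> = (\<Sum>f\<in>?M. 1 - card ?M / (?r * N (f i)))"
    by (simp add: sum_subtractf sum_distrib_left)
  \<comment> \<open>Gibbs' inequality by hand: \<open>ln x <= x - 1\<close> at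
    \<open>x = card ?M / (?r * N (f i))\<close>, summed over \<open>f\<close>.\<close>
  also have "\<dots> \<le> (\<Sum>f\<in>?M. ln (N (f i)) + ln ?r - ln (card ?M))"
  proof (rule sum_mono)
    fix f assume "f \<in> ?M"
    then have pos: "0 < real (N (f i))" using Npos by simp
    have "ln (card ?M / (?r * N (f i))) \<le> card ?M / (?r * N (f i)) - 1"
      using pos r cM by (intro ln_le_minus_one) simp
    also have "ln (card ?M / (?r * N (f i))) = ln (card ?M) - ln ?r - ln (N (f i))"
      using pos r cM by (simp add: ln_div ln_mult)
    finally show "1 - card ?M / (?r * N (f i)) \<le> ln (N (f i)) + ln ?r - ln (card ?M)"
      by simp
  qed
  also have "\<dots> = (\<Sum>f\<in>?M. ln (N (f i))) + card ?M * ln ?r - card ?M * ln (card ?M)"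
    by (simp add: sum_subtractf sum.distrib)
  finally show ?thesis by (simp add: N_def)
qed simp

text \<open>
  Schrijver's proof in logarithmic form: sum the entropy inequality over all rows, apply the
  induction hypothesis to the minors, and swap the sums over rows. For an empty row the junk value
  \<open>ln 1 / 0 = 0\<close> is harmless, since there are no matchings then.
\<close>

lemma bregman:
  fixes I :: "'a set" and A :: "'a \<Rightarrow> 'b set"
  assumes "finite I" "finite J" "card J = card I" "\<And>i. i \<in> I \<Longrightarrow> A i \<subseteq> J"
  shows "real (card (matchings I A)) \<le> exp (\<Sum>i\<in>I. ln (fact (card (A i))) / card (A i))"
  using assms
proof (induction "card I" arbitrary: I J A)
  case 0
  then have "matchings I A \<subseteq> {\<lambda>_. undefined}" by (auto simp: matchings_def)
  then have "card (matchings I A) \<le> card {\<lambda>_::'a. undefined :: 'b}" by (intro card_mono) auto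
  with 0 show ?case by simp
next
  case (Suc m)
  let ?M = "matchings I A"
  define h :: "nat \<Rightarrow> real" where "h r = ln (fact r) / r" for r
  have finA: "finite (A i)" if "i \<in> I" for i
    using that Suc.prems finite_subset by blast
  have fin: "finite ?M" using Suc.prems(1) finA by (rule finite_matchings)
  \<comment> \<open>Also true at \<open>r = 0\<close>, where both sides are 0; this covers rows of
    size 1, where \<open>?r - 1 = 0\<close> below.\<close>
  have hr: "real r * h r = ln (fact r)" for r by (simp add: h_def)
  show ?case
  proof (cases "?M = {}")
    case False
    have cM: "0 < real (card ?M)" using False fin by (simp add: card_gt_0_iff)
    have I: "0 < real (card I)" using Suc.hyps(2) by simp
    define N where "N f i = card {g \<in> ?M. g i = f i}" for f i
    have step: "ln (N f i) \<le> (\<Sum>j\<in>I - {i}. h (card (A j - {f i})))" if f: "f \<in> ?M" and i: "i \<in> I" for f i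
    proof -
      have fi: "f i \<in> A i" using f i by (auto simp: matchings_def)
      then have fJ: "f i \<in> J" using i Suc.prems by blast
      have "real (card (matchings (I - {i}) (\<lambda>j. A j - {f i}))) \<le>
        exp (\<Sum>j\<in>I - {i}. ln (fact (card (A j - {f i}))) / card (A j - {f i}))"
        using Suc.prems Suc.hyps(2) i fJ by (intro Suc.hyps(1)[where J = "J - {f i}"]) auto
      then have le: "N f i \<le> exp (\<Sum>j\<in>I - {i}. h (card (A j - {f i})))"
        unfolding N_def h_def using card_matchings_fixing[of i I "f i" A, OF i fi] by simp
      have "0 < N f i" using f fin unfolding N_def by (subst card_gt_0_iff) auto
      then have "ln (N f i) \<le> ln (exp (\<Sum>j\<in>I - {i}. h (card (A j - {f i}))))"
        using le by (subst ln_le_cancel_iff) auto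
      then show ?thesis by simp
    qed
    have inner: "(\<Sum>i\<in>I. ln (N f i)) \<le> (\<Sum>j\<in>I. card I * h (card (A j)) - ln (card (A j)))"
      if f: "f \<in> ?M" for f
    proof -
      have inj: "inj_on f I" and fA: "\<And>i. i \<in> I \<Longrightarrow> f i \<in> A i"
        using f by (auto simp: matchings_def)
      have "f ` I = J"
        using Suc.prems fA inj by (intro card_subset_eq) (auto simp: card_image)
      have "(\<Sum>i\<in>I. ln (N f i)) \<le> (\<Sum>i\<in>I. \<Sum>j\<in>I - {i}. h (card (A j - {f i})))"
        using step[OF f] by (intro sum_mono) auto
      also have "\<dots> = (\<Sum>i\<in>I. \<Sum>j\<in>{j\<in>I. j \<noteq> i}. h (card (A j - {f i})))"
        by (intro sum.cong) auto
      also have "\<dots> = (\<Sum>j\<in>I. \<Sum>i\<in>{i\<in>I. j \<noteq> i}. h (card (A j - {f i})))"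
        using Suc.prems by (intro sum.swap_restrict)
      also have "\<dots> = (\<Sum>j\<in>I. card I * h (card (A j)) - ln (card (A j)))"
      proof (rule sum.cong)
        fix j assume j: "j \<in> I"
        let ?r = "card (A j)"
        \<comment> \<open>Since \<open>f\<close> maps onto \<open>J\<close>, exactly
          \<open>?r\<close> rows take their value in \<open>A j\<close>, and \<open>j\<close> is one
          of them. Deleting the column \<open>f i\<close> shrinks row \<open>j\<close> to size
          \<open>?r - 1\<close> for the other \<open>?r - 1\<close> rows \<open>i\<close> of
          \<open>?K\<close>, and leaves it unchanged for \<open>i\<close> outside
          \<open>?K\<close>.\<close>
        let ?K = "{i \<in> I. f i \<in> A j}"
        have rp: "0 < ?r" using fA[OF j] finA[OF j] by (auto simp: card_gt_0_iff)
        have "f ` ?K = A j" using \<open>f ` I = J\<close> Suc.prems(4)[OF j] by auto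
        then have K: "card ?K = ?r"
          using inj by (metis (mono_tags) card_image inj_on_subset mem_Collect_eq subsetI)
        have finI: "finite I" by fact
        have rI: "?r \<le> card I" unfolding K[symmetric] using finI by (intro card_mono) auto
        have jK: "j \<in> ?K" using j fA by auto
        have "(\<Sum>i\<in>{i\<in>I. j \<noteq> i}. h (card (A j - {f i}))) =
              (\<Sum>i\<in>(I - ?K) \<union> (?K - {j}). h (card (A j - {f i})))"
          using jK by (intro sum.cong) auto
        also have "\<dots> = (\<Sum>i\<in>I - ?K. h (card (A j - {f i}))) + (\<Sum>i\<in>?K - {j}. h (card (A j - {f i})))"
          using finI by (intro sum.union_disjoint) auto
        also have "(\<Sum>i\<in>I - ?K. h (card (A j - {f i}))) = (\<Sum>i\<in>I - ?K. h ?r)"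
          by (intro sum.cong) auto
        also have "\<dots> = (real (card I) - ?r) * h ?r"
          using finI K rI by (simp add: card_Diff_subset of_nat_diff)
        also have "(\<Sum>i\<in>?K - {j}. h (card (A j - {f i}))) = (\<Sum>i\<in>?K - {j}. h (?r - 1))"
          using finA[OF j] by (intro sum.cong) auto
        also have "\<dots> = real (?r - 1) * h (?r - 1)"
          using finI jK K by simp
        also have "\<dots> = ln (fact (?r - 1))" by (rule hr)
        also have "\<dots> = ln (fact ?r) - ln ?r"
          using rp by (subst fact_reduce[of ?r]) (simp_all add: ln_mult)
        also have "(real (card I) - ?r) * h ?r = card I * h ?r - ln (fact ?r)"
          by (simp add: left_diff_distrib hr)
        finally show "(\<Sum>i\<in>{i\<in>I. j \<noteq> i}. h (card (A j - {f i}))) = card I * h ?r - ln ?r"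
          by simp
      qed simp
      finally show ?thesis .
    qed
    have "card I * (card ?M * ln (card ?M)) =
      (\<Sum>i\<in>I. card ?M * ln (card ?M))" by simp
    also have "\<dots> \<le> (\<Sum>i\<in>I. card ?M * ln (card (A i)) + (\<Sum>f\<in>?M. ln (N f i)))"
      unfolding N_def using fin finA by (intro sum_mono matching_entropy_le) auto
    also have "\<dots> = card ?M * (\<Sum>i\<in>I. ln (card (A i))) + (\<Sum>f\<in>?M. \<Sum>i\<in>I. ln (N f i))"
      unfolding sum.distrib sum_distrib_left by (subst sum.swap[of _ I]) simp
    also have "\<dots> \<le> card ?M * (\<Sum>i\<in>I. ln (card (A i))) +
        (\<Sum>f\<in>?M. (\<Sum>j\<in>I. card I * h (card (A j)) - ln (card (A j))))"
      by (intro add_left_mono) (rule sum_mono, rule inner)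
    \<comment> \<open>The terms \<open>ln (card (A i))\<close> of the entropy bound cancel against
      those from \<open>inner\<close>; what remains has the common factor
      \<open>card I * card ?M\<close>.\<close>
    also have "\<dots> = card I * (card ?M * (\<Sum>i\<in>I. h (card (A i))))"
      by (simp add: sum_subtractf flip: sum_distrib_left) (simp add: algebra_simps)
    finally have "ln (card ?M) \<le> (\<Sum>i\<in>I. h (card (A i)))"
      using cM I by simp
    then have "exp (ln (card ?M)) \<le> exp (\<Sum>i\<in>I. h (card (A i)))"
      by (subst exp_le_cancel_iff)
    then show ?thesis using cM by (simp add: h_def)
  qed simp
qed

section \<open>The number of derangements\<close>

text \<open>Up to sign, Lagrange's remainder at -1 after the term of degree \<open>n\<close> is
  \<open>exp t / (n+1)!\<close> with \<open>|t| <= 1\<close>. Multiplied by \<open>n!\<close> it is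
  below \<open>3 / (n+1)\<close>, which is at most 1/2 from \<open>n = 5\<close> on.\<close>

lemma exp_minus_one_taylor:
  fixes n :: nat
  assumes "n \<ge> 5"
  shows "\<bar>(\<Sum>k\<le>n. (-1) ^ k * fact n / fact k) - fact n / exp 1\<bar> < (1 / 2 :: real)"
proof -
  obtain t where t: "\<bar>t\<bar> \<le> \<bar>-1::real\<bar>"
    "exp (-1::real) = (\<Sum>m<Suc n. (-1) ^ m / fact m) + exp t / fact (Suc n) * (-1) ^ Suc n"
    using Maclaurin_exp_le[of "-1" "Suc n"] by blast
  have "fact n / exp (1::real) = fact n * exp (-1)"
    by (simp add: exp_minus divide_inverse)
  also have "\<dots> = (\<Sum>k\<le>n. (-1) ^ k * fact n / fact k) + fact n / fact (Suc n) * exp t * (-1) ^ Suc n"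
    unfolding t(2) by (simp only: sum_distrib_left lessThan_Suc_atMost distrib_left) (simp add: mult_ac)
  also have "fact n / fact (Suc n) = (1 / real (Suc n))" by simp
  finally have "\<bar>(\<Sum>k\<le>n. (-1) ^ k * fact n / fact k) - fact n / exp 1\<bar> = 1 / real (Suc n) * exp t"
    by (simp add: abs_mult power_abs)
  also have "\<dots> < 1 / real (Suc n) * 3"
  proof (rule mult_strict_left_mono)
    have "exp t \<le> exp 1" using t(1) by simp
    also have "exp 1 < (3::real)" using e_less_272 by simp
    finally show "exp t < 3" .
  qed simp
  also have "\<dots> \<le> 1 / 2" using assms by (simp add: field_simps)
  finally show ?thesis .
qed

text \<open>Inclusion-exclusion: the indicator of having no fixed point is a product over
  \<open>j\<close> of 1 minus the indicator of \<open>\<pi> j = j\<close>, expanded over subsets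
  \<open>X\<close>. The permutations fixing \<open>X\<close> pointwise are those of its complement,
  \<open>(n - card X)!\<close> in number.\<close>

lemma card_derangements_sum:
  "real (card (derangements n)) = (\<Sum>k\<le>n. (-1) ^ k * fact n / fact k)"
proof -
  let ?I = "{1..n}" and ?P = "{\<pi>. \<pi> permutes {1..n}}"
  have finP: "finite ?P" by (simp add: finite_permutations)
  have D: "derangements n = {\<pi> \<in> ?P. \<forall>j\<in>?I. \<pi> j \<noteq> j}"
    by (auto simp: derangements_def)
  have fixing: "{\<pi> \<in> ?P. \<forall>j\<in>X. \<pi> j = j} = {\<pi>. \<pi> permutes (?I - X)}" if "X \<subseteq> ?I" for X
    using that permutes_superset[of _ ?I "?I - X"] permutes_subset[of _ "?I - X" ?I]
    by (auto simp: permutes_not_in)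
  have "real (card (derangements n)) = (\<Sum>\<pi>\<in>?P. \<Prod>j\<in>?I. 1 - of_bool (\<pi> j = j))"
  proof -
    have "(\<Prod>j\<in>?I. 1 - of_bool (\<pi> j = j) :: real) = of_bool (\<forall>j\<in>?I. \<pi> j \<noteq> j)" for \<pi> :: "nat \<Rightarrow> nat"
      by (auto simp: prod_zero_iff)
    then show ?thesis
      unfolding D using finP by (simp add: of_bool_def sum.If_cases Int_def)
  qed
  also have "\<dots> = (\<Sum>\<pi>\<in>?P. \<Sum>X\<in>Pow ?I. (-1) ^ card X * of_bool (\<forall>j\<in>X. \<pi> j = j))"
  proof (intro sum.cong refl)
    fix \<pi> :: "nat \<Rightarrow> nat"
    have "(\<Prod>j\<in>X. of_bool (\<pi> j = j) :: real) = of_bool (\<forall>j\<in>X. \<pi> j = j)" if "X \<in> Pow ?I" for X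
      using finite_subset[of X ?I] that by (auto simp: prod_zero_iff)
    then show "(\<Prod>j\<in>?I. 1 - of_bool (\<pi> j = j) :: real) =
        (\<Sum>X\<in>Pow ?I. (-1) ^ card X * of_bool (\<forall>j\<in>X. \<pi> j = j))"
      by (subst prod_diff_conv_sum) (auto intro!: sum.cong)
  qed
  also have "\<dots> = (\<Sum>X\<in>Pow ?I. (-1) ^ card X * real (card {\<pi> \<in> ?P. \<forall>j\<in>X. \<pi> j = j}))"
    using finP by (subst sum.swap) (simp add: of_bool_def sum.If_cases Int_def flip: sum_distrib_left)
  also have "\<dots> = (\<Sum>X\<in>Pow ?I. (-1) ^ card X * fact (n - card X))"
  proof (intro sum.cong refl)
    fix X assume X: "X \<in> Pow ?I"
    then have "card (?I - X) = n - card X"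
      using finite_subset[of X ?I] by (subst card_Diff_subset) auto
    then have "card {\<pi>. \<pi> permutes (?I - X)} = fact (n - card X)"
      by (intro card_permutations) auto
    then show "(-1) ^ card X * real (card {\<pi> \<in> ?P. \<forall>j\<in>X. \<pi> j = j}) = (-1) ^ card X * fact (n - card X)"
      using X by (subst fixing) auto
  qed
  also have "\<dots> = (\<Sum>k\<le>n. \<Sum>X\<in>{X \<in> Pow ?I. card X = k}. (-1) ^ card X * fact (n - card X))"
    using card_mono[of ?I] by (intro sum.group[symmetric]) auto
  also have "\<dots> = (\<Sum>k\<le>n. (-1) ^ k * fact n / fact k)"
  proof (intro sum.cong refl)
    fix k assume k: "k \<in> {..n}"
    have "(\<Sum>X\<in>{X \<in> Pow ?I. card X = k}. (-1) ^ card X * fact (n - card X)) =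
          real (n choose k) * ((-1) ^ k * fact (n - k))"
      using n_subsets[of ?I k] by simp
    also have "\<dots> = (-1) ^ k * fact n / fact k"
      using k by (simp add: binomial_fact)
    finally show "(\<Sum>X\<in>{X \<in> Pow ?I. card X = k}. (-1) ^ card X * fact (n - card X)) =
      ((-1) ^ k * fact n / fact k :: real)" .
  qed
  finally show ?thesis .
qed

lemma card_derangements:
  assumes "n \<ge> 5"
  shows "round (fact n / exp 1 :: real) = int (card (derangements n))"
  using exp_minus_one_taylor[OF assms] card_derangements_sum[of n]
  by (intro round_unique') (simp add: abs_minus_commute)

section \<open>Latin squares and their completions\<close>

lemma latin_squaresD:
  assumes "L \<in> latin_squares n"
  shows "i \<in> {1..n} \<Longrightarrow> L i permutes {1..n}"
    and "i \<notin> {1..n} \<Longrightarrow> L i = undefined"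
    and "j \<in> {1..n} \<Longrightarrow> bij_betw (\<lambda>i. L i j) {1..n} {1..n}"
proof -
  have *: "L \<in> {1..n} \<rightarrow>\<^sub>E {\<pi>. \<pi> permutes {1..n}}"
    "\<forall>j\<in>{1..n}. bij_betw (\<lambda>i. L i j) {1..n} {1..n}"
    using assms unfolding latin_squares_def by blast+
  show "i \<in> {1..n} \<Longrightarrow> L i permutes {1..n}" using PiE_mem[OF *(1)] by blast
  show "i \<notin> {1..n} \<Longrightarrow> L i = undefined" by (rule PiE_arb[OF *(1)])
  show "j \<in> {1..n} \<Longrightarrow> bij_betw (\<lambda>i. L i j) {1..n} {1..n}" using *(2) by blast
qed

lemma latin_squares_ext:
  assumes "L \<in> latin_squares n" "M \<in> latin_squares n"
    and "\<And>i. i \<in> {1..n} \<Longrightarrow> L i = M i"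
  shows "L = M"
proof
  show "L i = M i" for i
    using assms(3) latin_squaresD(2)[OF assms(1)] latin_squaresD(2)[OF assms(2)] by metis
qed

lemma finite_latin_squares: "finite (latin_squares n)"
proof -
  have "latin_squares n \<subseteq> {1..n} \<rightarrow>\<^sub>E {\<pi>. \<pi> permutes {1..n}}"
    by (auto simp: latin_squares_def)
  then show ?thesis
    by (rule finite_subset) (auto intro!: finite_PiE simp: finite_permutations)
qed

lemma latin_square_column_inj:
  assumes "L \<in> latin_squares n" "j \<in> {1..n}" "i \<in> {1..n}" "i' \<in> {1..n}" "L i j = L i' j"
  shows "i = i'"
  using bij_betw_imp_inj_on[OF latin_squaresD(3)[OF assms(1,2)]] assms(5,3,4) by (rule inj_onD)

text \<open>Each column is a permutation, so its one missing entry is forced. Hence two of the three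
  new rows determine a completion.\<close>

lemma latin_square_last_row:
  assumes L: "L \<in> latin_squares n" and M: "M \<in> latin_squares n" and k: "k \<in> {1..n}"
    and eq: "\<And>i. i \<in> {1..n} - {k} \<Longrightarrow> L i = M i"
  shows "L = M"
proof (rule latin_squares_ext[OF L M])
  have "L k j = M k j" if j: "j \<in> {1..n}" for j
  proof -
    have "L k j \<in> (\<lambda>i. M i j) ` {1..n}"
      unfolding bij_betw_imp_surj_on[OF latin_squaresD(3)[OF M j]]
      using bij_betwE[OF latin_squaresD(3)[OF L j]] k by blast
    then obtain i where i: "i \<in> {1..n}" "L k j = M i j" by auto
    show ?thesis
    proof (cases "i = k")
      case False
      then have "L k j = L i j" using i eq[of i] by simp
      then show ?thesis using latin_square_column_inj[OF L j k i(1)] False by blast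
    qed (use i in simp)
  qed
  moreover have "L k j = M k j" if "j \<notin> {1..n}" for j
    using that latin_squaresD(1)[OF L k] latin_squaresD(1)[OF M k] by (simp add: permutes_not_in)
  ultimately have "L k = M k" by blast
  then show "L i = M i" if "i \<in> {1..n}" for i using eq that by blast
qed

section \<open>The bound on the number of completions\<close>

lemma exp_sum_const_ln:
  assumes "x > 0" "\<And>i. i \<in> {1..n} \<Longrightarrow> f i = ln x / (k :: real)"
  shows "exp (\<Sum>i\<in>{1..n}. f i) = x powr (real n / k)"
proof -
  have "(\<Sum>i\<in>{1..n}. f i) = (\<Sum>i\<in>{1..n}. ln x / k)"
    using assms(2) by (rule sum.cong[OF refl])
  then show ?thesis using assms(1) by (simp add: powr_def)
qed

text \<open>A completion is sent to its rows \<open>n - 2\<close> and \<open>n - 1\<close>,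
  injectively because the last row is then forced. Bregman's inequality bounds the choices of row
  \<open>n - 1\<close> for each fixed row \<open>n - 2\<close>, and then those of row
  \<open>n - 2\<close>. The count is an integer, so the bound passes to the floor.\<close>

lemma card_completions_le:
  assumes n: "n \<ge> 3"
  shows "int (card (completions n R)) \<le> completion_bound n"
proof (cases "completions n R = {}")
  case True
  have "0 \<le> completion_bound n" unfolding completion_bound_def zero_le_floor by (intro mult_nonneg_nonneg powr_ge_zero)
  then show ?thesis unfolding True by simp
next
  case False
  let ?I = "{1..n}" and ?C = "completions n R"
  \<comment> \<open>\<open>A j\<close> holds the symbols still free in column \<open>j\<close> below
    row \<open>n - 3\<close>; \<open>B f j\<close> is what remains once row \<open>n - 2\<close> is
    \<open>f\<close>.\<close>
  define A where "A j = ?I - (\<lambda>i. R i j) ` {1..n-3}" for j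
  define B where "B f j = A j - {f j}" for f :: "nat \<Rightarrow> nat" and j
  have CL: "L \<in> latin_squares n" "\<And>i. i \<in> {1..n-3} \<Longrightarrow> L i = R i" if "L \<in> ?C" for L
    using that by (auto simp: completions_def)
  \<comment> \<open>The given rows belong to an actual Latin square, so they do not repeat a symbol
    in column \<open>j\<close>; this is why the case without completions is separated.\<close>
  have cA: "card (A j) = 3" if j: "j \<in> ?I" for j
  proof -
    obtain L where L: "L \<in> ?C" using False by blast
    have "(\<lambda>i. R i j) ` {1..n-3} = (\<lambda>i. L i j) ` {1..n-3}"
      using CL(2)[OF L] by (intro image_cong) auto
    moreover have "inj_on (\<lambda>i. L i j) {1..n-3}"
      using bij_betw_imp_inj_on[OF latin_squaresD(3)[OF CL(1)[OF L] j]] by (rule inj_on_subset) auto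
    moreover have "(\<lambda>i. L i j) ` {1..n-3} \<subseteq> ?I"
      using bij_betwE[OF latin_squaresD(3)[OF CL(1)[OF L] j]] by auto
    ultimately show ?thesis
      unfolding A_def using n by (simp add: card_Diff_subset card_image)
  qed
  have A: "L i j \<in> A j" if L: "L \<in> ?C" and i: "i \<in> {n-2..n}" and j: "j \<in> ?I" for L i j
  proof -
    have iI: "i \<in> ?I" using i n by auto
    have "L i j \<noteq> R i' j" if "i' \<in> {1..n-3}" for i'
    proof
      assume "L i j = R i' j"
      then have "L i j = L i' j" using CL(2)[OF L that] by simp
      moreover have "i' \<in> ?I" using that by auto
      ultimately have "i = i'" using latin_square_column_inj[OF CL(1)[OF L] j iI] by blast
      then show False using i that n by auto
    qed
    moreover have "L i j \<in> ?I"
      using bij_betwE[OF latin_squaresD(3)[OF CL(1)[OF L] j]] iI by blast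
    ultimately show ?thesis unfolding A_def by blast
  qed
  have finA: "finite (A j)" for j by (simp add: A_def)
  have cB: "card (B f j) = 2" if f: "f \<in> matchings ?I A" and j: "j \<in> ?I" for f j
  proof -
    have "f j \<in> A j" using f j by (auto simp: matchings_def)
    then show ?thesis using cA[OF j] finA[of j] by (simp add: B_def)
  qed
  have sub: "A j \<subseteq> ?I" "B f j \<subseteq> ?I" for f j by (auto simp: A_def B_def)
  let ?S = "SIGMA f:matchings ?I A. matchings ?I (B f)"
  \<comment> \<open>Matchings are \<open>undefined\<close> outside \<open>{1..n}\<close> while
    permutations are the identity there, hence the restriction; it loses no information.\<close>
  let ?\<Phi> = "\<lambda>L. (restrict (L (n-2)) ?I, restrict (L (n-1)) ?I)"
  have row: "L i permutes ?I" if "L \<in> ?C" "i \<in> ?I" for L i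
    using latin_squaresD(1)[OF CL(1)] that by blast
  have finB: "finite (B f j)" for f j by (simp add: A_def B_def)
  have finM: "finite (matchings ?I A)" "finite (matchings ?I (B f))" for f
    using finA finB by (simp_all add: finite_matchings)
  have "card ?C \<le> card ?S"
  proof (rule card_inj_on_le)
    show "?\<Phi> ` ?C \<subseteq> ?S"
    proof (rule image_subsetI)
      fix L assume L: "L \<in> ?C"
      have inj: "inj_on (restrict (L i) ?I) ?I" if "i \<in> ?I" for i
        using permutes_inj_on[OF row[OF L that]] by (simp add: inj_on_restrict_eq)
      have "restrict (L (n-2)) ?I \<in> matchings ?I A"
        using inj[of "n-2"] A[OF L, of "n-2"] n by (auto simp: matchings_def)
      moreover have "L (n-1) j \<noteq> L (n-2) j" if "j \<in> ?I" for j
      proof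
        assume "L (n-1) j = L (n-2) j"
        moreover have "n-1 \<in> ?I" "n-2 \<in> ?I" using n by auto
        ultimately have "n-1 = n-2" using latin_square_column_inj[OF CL(1)[OF L] that] by blast
        then show False using n by simp
      qed
      then have "restrict (L (n-1)) ?I \<in> matchings ?I (B (restrict (L (n-2)) ?I))"
        using inj[of "n-1"] A[OF L, of "n-1"] n by (auto simp: matchings_def B_def)
      ultimately show "?\<Phi> L \<in> ?S" by simp
    qed
    show "inj_on ?\<Phi> ?C"
    proof (rule inj_onI)
      fix L M assume L: "L \<in> ?C" and M: "M \<in> ?C" and eq: "?\<Phi> L = ?\<Phi> M"
      have restr: "L i = M i" if "i \<in> ?I" "restrict (L i) ?I = restrict (M i) ?I" for i
      proof
        fix j
        show "L i j = M i j"
          using fun_cong[OF that(2), of j] row[OF L that(1)] row[OF M that(1)]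
          by (cases "j \<in> ?I") (auto simp: permutes_not_in)
      qed
      show "L = M"
      proof (rule latin_square_last_row[OF CL(1)[OF L] CL(1)[OF M], of n])
        show "n \<in> ?I" using n by simp
        fix i assume "i \<in> ?I - {n}"
        then consider "i \<in> {1..n-3}" | "i = n-2" "i \<in> ?I" | "i = n-1" "i \<in> ?I"
          by (cases "i \<le> n - 3"; cases "i = n - 1") auto
        then show "L i = M i"
          using CL(2)[OF L, of i] CL(2)[OF M, of i] restr[of i] eq by cases auto
      qed
    qed
    show "finite ?S" using finM by auto
  qed
  also have "card ?S = (\<Sum>f\<in>matchings ?I A. card (matchings ?I (B f)))"
    using finM by simp
  finally have "real (card ?C) \<le> (\<Sum>f\<in>matchings ?I A. real (card (matchings ?I (B f))))"
    by (simp flip: of_nat_sum)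
  also have "\<dots> \<le> (\<Sum>f\<in>matchings ?I A. 2 powr (n / 2))"
  proof (rule sum_mono)
    fix f assume f: "f \<in> matchings ?I A"
    have "real (card (matchings ?I (B f))) \<le> exp (\<Sum>i\<in>?I. ln (fact (card (B f i))) / card (B f i))"
      using sub by (intro bregman[where J = ?I]) auto
    \<comment> \<open>Every row has size 2, so each summand is \<open>ln 2 / 2\<close>; for
      \<open>A\<close> below it is \<open>ln 6 / 3\<close>.\<close>
    also have "\<dots> = 2 powr (n / 2)"
      by (rule exp_sum_const_ln) (simp_all add: cB[OF f])
    finally show "real (card (matchings ?I (B f))) \<le> 2 powr (n / 2)" .
  qed
  also have "\<dots> = real (card (matchings ?I A)) * 2 powr (n / 2)" by simp
  also have "\<dots> \<le> 6 powr (n / 3) * 2 powr (n / 2)"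
  proof (rule mult_right_mono)
    have "real (card (matchings ?I A)) \<le> exp (\<Sum>i\<in>?I. ln (fact (card (A i))) / card (A i))"
      using sub by (intro bregman[where J = ?I]) auto
    also have "\<dots> = 6 powr (n / 3)"
      by (rule exp_sum_const_ln) (simp_all add: cA fact_numeral)
    finally show "real (card (matchings ?I A)) \<le> 6 powr (n / 3)" .
  qed simp
  finally show ?thesis
    by (simp add: completion_bound_def le_floor_iff)
qed

section \<open>Normalized squares and relabelling\<close>

definition normalized_squares :: "nat \<Rightarrow> (nat \<Rightarrow> nat \<Rightarrow> nat) set" where
  "normalized_squares n = {L \<in> latin_squares n. L 1 = id}"

text \<open>The joint effect of the two final random permutations, in the shape of the term returned
  by \<open>pdc_sampling\<close>.\<close>

definition relabel :: "nat \<Rightarrow> (nat \<Rightarrow> nat) \<Rightarrow> (nat \<Rightarrow> nat) \<Rightarrow> (nat \<Rightarrow> nat \<Rightarrow> nat) \<Rightarrow> nat \<Rightarrow> nat \<Rightarrow> nat" where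
  "relabel n \<rho> \<sigma> L = (\<lambda>i\<in>{1..n}. \<lambda>j. \<sigma> (L (\<rho> i) j))"

lemma relabel_latin:
  assumes L: "L \<in> latin_squares n" and \<rho>: "\<rho> permutes {1..n}" and \<sigma>: "\<sigma> permutes {1..n}"
  shows "relabel n \<rho> \<sigma> L \<in> latin_squares n"
proof -
  have "(\<lambda>j. \<sigma> (L (\<rho> i) j)) permutes {1..n}" if "i \<in> {1..n}" for i
  proof -
    have "L (\<rho> i) permutes {1..n}"
      using latin_squaresD(1)[OF L] permutes_in_image[OF \<rho>] that by blast
    then show ?thesis using permutes_compose[OF _ \<sigma>] by (simp add: o_def)
  qed
  then have "relabel n \<rho> \<sigma> L \<in> {1..n} \<rightarrow>\<^sub>E {\<pi>. \<pi> permutes {1..n}}"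
    by (simp add: relabel_def)
  moreover have "bij_betw (\<lambda>i. relabel n \<rho> \<sigma> L i j) {1..n} {1..n}" if j: "j \<in> {1..n}" for j
  proof -
    have "bij_betw (\<sigma> \<circ> ((\<lambda>i. L i j) \<circ> \<rho>)) {1..n} {1..n}"
      by (intro bij_betw_trans[OF bij_betw_trans[OF permutes_imp_bij[OF \<rho>] latin_squaresD(3)[OF L j]]]
        permutes_imp_bij[OF \<sigma>])
    then show ?thesis
      by (rule bij_betw_cong[THEN iffD1, rotated]) (simp add: relabel_def)
  qed
  ultimately show ?thesis unfolding latin_squares_def by blast
qed

lemma relabel_inv:
  assumes L: "L \<in> latin_squares n" and \<rho>: "\<rho> permutes {1..n}" and \<sigma>: "\<sigma> permutes {1..n}"
  shows "relabel n (inv \<rho>) (inv \<sigma>) (relabel n \<rho> \<sigma> L) = L"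
    and "relabel n \<rho> \<sigma> (relabel n (inv \<rho>) (inv \<sigma>) L) = L"
proof -
  have *: "inv \<rho> i \<in> {1..n} \<longleftrightarrow> i \<in> {1..n}" "\<rho> i \<in> {1..n} \<longleftrightarrow> i \<in> {1..n}" for i
    using permutes_in_image[OF permutes_inv[OF \<rho>]] permutes_in_image[OF \<rho>] by blast+
  show "relabel n (inv \<rho>) (inv \<sigma>) (relabel n \<rho> \<sigma> L) = L"
    by (rule latin_squares_ext[OF relabel_latin[OF relabel_latin[OF L \<rho> \<sigma>] permutes_inv[OF \<rho>] permutes_inv[OF \<sigma>]] L])
      (simp add: relabel_def * permutes_inverses[OF \<rho>] permutes_inverses[OF \<sigma>] del: atLeastAtMost_iff One_nat_def)
  show "relabel n \<rho> \<sigma> (relabel n (inv \<rho>) (inv \<sigma>) L) = L"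
    by (rule latin_squares_ext[OF relabel_latin[OF relabel_latin[OF L permutes_inv[OF \<rho>] permutes_inv[OF \<sigma>]] \<rho> \<sigma>] L])
      (simp add: relabel_def * permutes_inverses[OF \<rho>] permutes_inverses[OF \<sigma>] del: atLeastAtMost_iff One_nat_def)
qed

text \<open>With \<open>k = inv \<rho> 1\<close>, the identity row of \<open>L\<close> ends up as
  row \<open>k\<close>, where it reads \<open>\<sigma>\<close>. So \<open>\<sigma>\<close> can be
  read off from the result, and then both permutations can be undone.\<close>

lemma bij_betw_relabel:
  assumes \<rho>: "\<rho> permutes {1..n}" and n: "n \<ge> 1"
  shows "bij_betw (\<lambda>(L, \<sigma>). relabel n \<rho> \<sigma> L)
    (normalized_squares n \<times> {\<sigma>. \<sigma> permutes {1..n}}) (latin_squares n)"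
proof -
  let ?k = "inv \<rho> 1"
  have k: "?k \<in> {1..n}" using permutes_in_image[OF permutes_inv[OF \<rho>], of 1] n by simp
  have \<rho>k: "\<rho> ?k = 1" by (rule permutes_inverses[OF \<rho>])
  have row: "relabel n \<rho> \<sigma> L ?k = \<sigma>" if "L \<in> normalized_squares n" for L \<sigma>
    using that k \<rho>k by (simp add: relabel_def normalized_squares_def)
  show ?thesis
  proof (rule bij_betw_byWitness[where f' = "\<lambda>M. (relabel n (inv \<rho>) (inv (M ?k)) M, M ?k)"])
    show "\<forall>x\<in>normalized_squares n \<times> {\<sigma>. \<sigma> permutes {1..n}}.
      (\<lambda>M. (relabel n (inv \<rho>) (inv (M ?k)) M, M ?k)) ((\<lambda>(L, \<sigma>). relabel n \<rho> \<sigma> L) x) = x"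
      using row relabel_inv(1)[OF _ \<rho>] by (auto simp: normalized_squares_def)
    show "\<forall>M\<in>latin_squares n. (\<lambda>(L, \<sigma>). relabel n \<rho> \<sigma> L) (relabel n (inv \<rho>) (inv (M ?k)) M, M ?k) = M"
      using relabel_inv(2)[OF _ \<rho>] latin_squaresD(1)[OF _ k] by auto
    show "(\<lambda>(L, \<sigma>). relabel n \<rho> \<sigma> L) ` (normalized_squares n \<times> {\<sigma>. \<sigma> permutes {1..n}}) \<subseteq> latin_squares n"
      using relabel_latin[OF _ \<rho>] by (auto simp: normalized_squares_def)
    show "(\<lambda>M. (relabel n (inv \<rho>) (inv (M ?k)) M, M ?k)) ` latin_squares n
      \<subseteq> normalized_squares n \<times> {\<sigma>. \<sigma> permutes {1..n}}"
    proof (rule image_subsetI)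
      fix M assume M: "M \<in> latin_squares n"
      have \<sigma>: "M ?k permutes {1..n}" by (rule latin_squaresD(1)[OF M k])
      have "relabel n (inv \<rho>) (inv (M ?k)) M 1 = id"
        using n permutes_inverses[OF \<sigma>] by (simp add: relabel_def fun_eq_iff)
      then show "(relabel n (inv \<rho>) (inv (M ?k)) M, M ?k) \<in> normalized_squares n \<times> {\<sigma>. \<sigma> permutes {1..n}}"
        using relabel_latin[OF M permutes_inv[OF \<rho>] permutes_inv[OF \<sigma>]] \<sigma>
        by (simp add: normalized_squares_def)
    qed
  qed
qed

lemma finite_normalized_squares: "finite (normalized_squares n)"
  using finite_latin_squares by (simp add: normalized_squares_def)

text \<open>The case \<open>\<rho> = id\<close> of the bijection. It accounts for the quotient of
  \<open>card (latin_squares n)\<close> by \<open>n!\<close> in the expected value.\<close>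

lemma card_latin_squares:
  assumes "n \<ge> 1"
  shows "card (latin_squares n) = card (normalized_squares n) * fact n"
  using bij_betw_same_card[OF bij_betw_relabel[OF permutes_id assms]]
  by (simp add: card_cartesian_product card_permutations[OF refl])

section \<open>Existence of a normalized square\<close>

lemma inj_on_add_mod:
  fixes c n :: nat
  shows "inj_on (\<lambda>i. (i + c) mod n + 1) {1..n}"
proof -
  have "x = y" if "x \<le> y" "x \<in> {1..n}" "y \<in> {1..n}" "(x + c) mod n = (y + c) mod n" for x y
  proof -
    have "n dvd (y + c) - (x + c)"
      using that by (intro mod_eq_dvd_iff_nat[THEN iffD1]) auto
    then show ?thesis using that by (cases "y - x = 0") (auto dest: dvd_imp_le)
  qed
  then show ?thesis by (intro inj_onI) (metis add_right_cancel nat_le_linear)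
qed

lemma bij_betw_add_mod:
  fixes c n :: nat
  shows "bij_betw (\<lambda>i. (i + c) mod n + 1) {1..n} {1..n}"
proof -
  have "(\<lambda>i. (i + c) mod n + 1) ` {1..n} \<subseteq> {1..n}"
    by (auto simp: Suc_le_eq)
  then show ?thesis
    using endo_inj_surj[OF _ _ inj_on_add_mod[of c n]] inj_on_add_mod[of c n] by (simp add: bij_betw_def)
qed

text \<open>The cyclic table, shifted so that symbols start at 1 and row 1 is the identity. It makes
  the uniform distributions below well defined and the acceptance probability positive.\<close>

lemma normalized_squares_nonempty:
  assumes n: "n \<ge> 1"
  shows "normalized_squares n \<noteq> {}"
proof -
  define L where "L = (\<lambda>i\<in>{1..n}. \<lambda>j. if j \<in> {1..n} then (i + j - 2) mod n + 1 else j)"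
  have "(\<lambda>j. if j \<in> {1..n} then (i + j - 2) mod n + 1 else j) permutes {1..n}" if i: "i \<in> {1..n}" for i
  proof (rule bij_imp_permutes)
    show "bij_betw (\<lambda>j. if j \<in> {1..n} then (i + j - 2) mod n + 1 else j) {1..n} {1..n}"
    \<comment> \<open>Row \<open>i\<close> is a shift by \<open>i - 2\<close>. For
      \<open>i = 1\<close> truncated subtraction would give 0 instead of -1, so that row is treated
      apart; likewise column 1 below.\<close>
    proof (cases "i = 1")
      case True
      have "bij_betw id {1..n} {1..n}" by simp
      then show ?thesis by (rule bij_betw_cong[THEN iffD1, rotated]) (use True in auto)
    next
      case False
      show ?thesis
        by (rule bij_betw_cong[THEN iffD1, OF _ bij_betw_add_mod[of "i - 2"]])
          (use i False in \<open>auto simp: algebra_simps\<close>)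
    qed
  qed (simp only: if_False)
  moreover have "bij_betw (\<lambda>i. L i j) {1..n} {1..n}" if j: "j \<in> {1..n}" for j
  proof (cases "j = 1")
    case True
    have "bij_betw id {1..n} {1..n}" by simp
    then show ?thesis by (rule bij_betw_cong[THEN iffD1, rotated]) (use True n in \<open>auto simp: L_def\<close>)
  next
    case False
    show ?thesis
      by (rule bij_betw_cong[THEN iffD1, OF _ bij_betw_add_mod[of "j - 2"]])
        (use j False in \<open>auto simp: L_def\<close>)
  qed
  ultimately have "L \<in> latin_squares n"
    by (simp add: latin_squares_def L_def)
  moreover have "L 1 = id"
    using n by (auto simp: L_def fun_eq_iff)
  ultimately show ?thesis by (auto simp: normalized_squares_def)
qed

section \<open>Choices of the rows 2 to n-3 and their completions\<close>

lemma normalized_square_row: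
  assumes L: "L \<in> normalized_squares n" and i: "i \<in> {2..n}"
  shows "L i \<in> derangements n"
proof -
  have LS: "L \<in> latin_squares n" and id: "L 1 = id"
    using L by (auto simp: normalized_squares_def)
  have iI: "i \<in> {1..n}" and 1: "1 \<in> {1..n}" using i by auto
  \<comment> \<open>Column \<open>j\<close> already contains the symbol \<open>j\<close> in row
    1.\<close>
  have "L i j \<noteq> j" if j: "j \<in> {1..n}" for j
  proof
    assume "L i j = j"
    then have "L i j = L 1 j" unfolding id by simp
    then have "i = 1" using latin_square_column_inj[OF LS j iI 1] by blast
    then show False using i by simp
  qed
  then show ?thesis using latin_squaresD(1)[OF LS iI] by (simp add: derangements_def)
qed

lemma finite_derangements: "finite (derangements n)"
  using finite_permutations[of "{1..n}"] by (auto simp: derangements_def intro: finite_subset)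

text \<open>The second row of a normalized square is a witness.\<close>

lemma derangements_nonempty:
  assumes "n \<ge> 2"
  shows "derangements n \<noteq> {}"
proof -
  obtain L where "L \<in> normalized_squares n" using normalized_squares_nonempty[of n] assms by auto
  then show ?thesis using normalized_square_row[of L n 2] assms by auto
qed

text \<open>The support of the product distribution in \<open>pdc_loop\<close>:
  \<open>Pi_pmf\<close> puts the default value outside \<open>{2..n-3}\<close>, also at index 1,
  which the loop overwrites with \<open>id\<close>.\<close>

definition row_choices :: "nat \<Rightarrow> (nat \<Rightarrow> nat \<Rightarrow> nat) set" where
  "row_choices n = PiE_dflt {2..n-3} undefined (\<lambda>_. derangements n)"

lemma finite_row_choices: "finite (row_choices n)"
  by (simp add: row_choices_def finite_PiE_dflt finite_derangements)

lemma card_row_choices: "card (row_choices n) = card (derangements n) ^ (n - 4)"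
proof -
  have "card {2..n-3} = n - 4" by simp
  then show ?thesis
    unfolding row_choices_def by (subst card_PiE_dflt) (simp_all add: finite_derangements)
qed

lemma row_choices_nonempty: "n \<ge> 2 \<Longrightarrow> row_choices n \<noteq> {}"
  by (simp add: row_choices_def derangements_nonempty)

lemma Pi_pmf_derangements:
  assumes "n \<ge> 2"
  shows "Pi_pmf {2..n-3} undefined (\<lambda>_. pmf_of_set (derangements n)) = pmf_of_set (row_choices n)"
  unfolding row_choices_def using assms
  by (intro Pi_pmf_of_set) (simp_all add: finite_derangements derangements_nonempty)

lemma completions_normalized:
  assumes n: "n \<ge> 4"
  shows "completions n (S(1 := id)) = {L \<in> normalized_squares n. \<forall>i\<in>{2..n-3}. L i = S i}"
proof -
  have "{1..n-3} = insert 1 {2..n-3}" using n by auto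
  then show ?thesis by (auto simp: completions_def normalized_squares_def)
qed

text \<open>Rows 2 to \<open>n-3\<close> of \<open>L\<close> are the only candidate, and it is a
  legal choice because these rows are derangements.\<close>

lemma completions_unique:
  assumes n: "n \<ge> 4" and L: "L \<in> normalized_squares n"
  shows "{S \<in> row_choices n. L \<in> completions n (S(1 := id))} =
    {\<lambda>i. if i \<in> {2..n-3} then L i else undefined}"
proof (intro equalityI subsetI)
  fix S assume "S \<in> {S \<in> row_choices n. L \<in> completions n (S(1 := id))}"
  then have S: "S \<in> row_choices n" "\<forall>i\<in>{2..n-3}. L i = S i"
    using completions_normalized[OF n, of S] by auto
  have "S = (\<lambda>i. if i \<in> {2..n-3} then L i else undefined)"
  proof
    show "S i = (if i \<in> {2..n-3} then L i else undefined)" for i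
      using S by (simp add: row_choices_def PiE_dflt_def)
  qed
  then show "S \<in> {\<lambda>i. if i \<in> {2..n-3} then L i else undefined}" by simp
next
  fix S assume "S \<in> {\<lambda>i. if i \<in> {2..n-3} then L i else undefined}"
  then have S: "S = (\<lambda>i. if i \<in> {2..n-3} then L i else undefined)" by simp
  have "L i \<in> derangements n" if "i \<in> {2..n-3}" for i
    using that by (intro normalized_square_row[OF L]) auto
  then have "S \<in> row_choices n" by (simp add: row_choices_def PiE_dflt_def S)
  then show "S \<in> {S \<in> row_choices n. L \<in> completions n (S(1 := id))}"
    unfolding completions_normalized[OF n] using L by (simp add: S)
qed

text \<open>Double counting of the pairs of a row choice and a normalized square completing it: each
  square lies in exactly one pair.\<close>

lemma sum_card_completions:
  assumes n: "n \<ge> 4"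
  shows "(\<Sum>S\<in>row_choices n. card (completions n (S(1 := id)))) = card (normalized_squares n)"
proof -
  have "(\<Sum>S\<in>row_choices n. card (completions n (S(1 := id)))) =
    (\<Sum>S\<in>row_choices n. \<Sum>L\<in>{L \<in> normalized_squares n. L \<in> completions n (S(1 := id))}. 1)"
  proof (intro sum.cong refl)
    fix S
    have "{L \<in> normalized_squares n. L \<in> completions n (S(1 := id))} = completions n (S(1 := id))"
      unfolding completions_normalized[OF n] by blast
    then show "card (completions n (S(1 := id))) =
        (\<Sum>L\<in>{L \<in> normalized_squares n. L \<in> completions n (S(1 := id))}. 1)"
      by (simp only: card_eq_sum)
  qed
  also have "\<dots> = (\<Sum>L\<in>normalized_squares n. \<Sum>S\<in>{S \<in> row_choices n. L \<in> completions n (S(1 := id))}. 1)"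
    by (intro sum.swap_restrict finite_row_choices finite_normalized_squares)
  also have "\<dots> = (\<Sum>L\<in>normalized_squares n. 1)"
    by (intro sum.cong refl) (simp add: completions_unique[OF n, unfolded One_nat_def])
  finally show ?thesis by simp
qed

lemma finite_completions: "finite (completions n R)"
  using finite_latin_squares by (simp add: completions_def)

lemma completion_bound_pos:
  shows "0 < completion_bound n"
proof -
  have "1 \<le> 6 powr (real n / 3)" "1 \<le> 2 powr (real n / 2)" 
    by (simp_all add: ge_one_powr_ge_zero)
  then have "1 * 1 \<le> 6 powr (real n / 3) * 2 powr (real n / 2)"
    by (intro mult_mono) auto
  then have "1 \<le> completion_bound n" unfolding completion_bound_def one_le_floor by simp
  then show ?thesis by simp
qed

section \<open>The rejection loop\<close>

text \<open>Within (0,1) the event \<open>U < q\<close> is the interval (0,q), of length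
  \<open>q\<close>. Above 1 the probability would be clipped, so the loop needs
  \<open>card_completions_le\<close> to apply this.\<close>

lemma uniform_less_eq_bernoulli:
  assumes "0 \<le> q" "q \<le> 1"
  shows "uniform_less q = bernoulli_pmf q"
proof -
  have "pmf (uniform_less q) True = measure (uniform_measure lborel {0<..<1::real}) {U. U < q}"
  proof -
    have [measurable]: "(\<lambda>U. U < q) \<in> measurable (uniform_measure lborel {0<..<1}) (count_space UNIV)"
      by measurable
    have "pmf (uniform_less q) True =
      measure (distr (uniform_measure lborel {0<..<1}) (count_space UNIV) (\<lambda>U. U < q)) {True}"
      by (simp add: pmf.rep_eq measure_pmf_uniform_less)
    also have "\<dots> = measure (uniform_measure lborel {0<..<1::real}) ((\<lambda>U. U < q) -` {True} \<inter> space (uniform_measure lborel {0<..<1}))"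
      by (rule measure_distr) simp_all
    finally show ?thesis by (simp add: vimage_def)
  qed
  also have "\<dots> = measure lborel ({0<..<1} \<inter> {U. U < q}) / measure lborel {0<..<1::real}"
    by (rule measure_uniform_measure) auto
  also have "{0<..<1} \<inter> {U. U < q} = {0<..<q}" using assms by auto
  also have "measure lborel {0<..<q} / measure lborel {0<..<1::real} = q" using assms by simp
  finally have T: "pmf (uniform_less q) True = q" .
  show ?thesis
  proof (rule pmf_eqI)
    fix b show "pmf (uniform_less q) b = pmf (bernoulli_pmf q) b"
      using T assms pmf_False_conv_True[of "uniform_less q"] by (cases b) simp_all
  qed
qed

text \<open>The mean of \<open>d / B\<close> over all row choices, that is, the probability that a
  single round accepts, with the sum of all \<open>d\<close> evaluated by
  \<open>sum_card_completions\<close>.\<close>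

definition acceptance_prob :: "nat \<Rightarrow> real" where
  "acceptance_prob n = real (card (normalized_squares n)) /
     (real_of_int (completion_bound n) * real (card (derangements n)) ^ (n - 4))"

text \<open>Unfolds the recursion once and averages over the row choices: a result with count
  \<open>t\<close> is either accepted at once, with \<open>t = 1\<close>, or stems from a rejection
  followed by a run with count \<open>t - 1\<close>.\<close>

lemma spmf_pdc_loop_step:
  assumes n: "n \<ge> 5"
  shows "spmf (pdc_loop n) (t, L) =
      (if t = 1 then acceptance_prob n * pmf (pmf_of_set (normalized_squares n)) L else 0)
    + (1 - acceptance_prob n) * (if t = 0 then 0 else spmf (pdc_loop n) (t - 1, L))"
proof -
  define B where "B = real_of_int (completion_bound n)"
  define C where "C S = completions n (S(1 := id))" for S :: "nat \<Rightarrow> nat \<Rightarrow> nat"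
  define q where "q S = real (card (C S)) / B" for S
  define P where "P = pmf_of_set (row_choices n)"
  let ?\<Omega> = "row_choices n" and ?N = "normalized_squares n"
  have B: "0 < B" using completion_bound_pos by (simp add: B_def)
  have q: "0 \<le> q S" "q S \<le> 1" for S
  proof -
    have "int (card (C S)) \<le> completion_bound n"
      unfolding C_def using n by (intro card_completions_le) simp
    then have "real (card (C S)) \<le> B" unfolding B_def by linarith
    then show "0 \<le> q S" "q S \<le> 1" using B by (simp_all add: q_def)
  qed
  have loop: "pdc_loop n = bind_pmf P (\<lambda>S. bind_pmf (bernoulli_pmf (q S))
      (\<lambda>b. if b then map_spmf (Pair (Suc 0)) (spmf_of_set (C S)) else map_spmf (apfst Suc) (pdc_loop n)))"
    by (subst pdc_loop.simps) (use n in \<open>simp add: Pi_pmf_derangements Let_def P_def q_def C_def B_def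
      uniform_less_eq_bernoulli[OF q, unfolded q_def C_def B_def One_nat_def] map_spmf_conv_bind_spmf
      apfst_def map_prod_def case_prod_beta' cong: if_cong\<close>)
  have A: "spmf (map_spmf (Pair (Suc 0)) (spmf_of_set (C S))) (t, L) =
     (if t = 1 then indicator (C S) L / card (C S) else 0)" for S
  proof (cases "t = 1")
    case True
    then show ?thesis
      using spmf_map_inj'[of "Pair (Suc 0)" "spmf_of_set (C S)" L] by (simp add: spmf_of_set inj_on_def)
  next
    case False
    then show ?thesis by (subst spmf_map_outside) auto
  qed
  have R: "spmf (map_spmf (apfst Suc) (pdc_loop n)) (t, L) =
      (if t = 0 then 0 else spmf (pdc_loop n) (t - 1, L))" (is "_ = ?R")
  proof (cases t)
    case 0
    then show ?thesis by (subst spmf_map_outside) auto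
  next
    case (Suc k)
    then show ?thesis
      using spmf_map_inj'[of "apfst Suc" "pdc_loop n" "(k, L)"] by simp
  qed
  have ne: "?\<Omega> \<noteq> {}" using n by (intro row_choices_nonempty) simp
  then have c\<Omega>: "0 < real (card ?\<Omega>)" by (simp add: card_gt_0_iff finite_row_choices)
  have "spmf (pdc_loop n) (t, L) = (\<Sum>S\<in>?\<Omega>. q S * (if t = 1 then indicator (C S) L / card (C S) else 0)
      + (1 - q S) * ?R) / card ?\<Omega>"
    by (subst loop) (simp add: pmf_bind P_def integral_pmf_of_set ne finite_row_choices q A R mult.commute)
  also have "(\<lambda>S. q S * (if t = 1 then indicator (C S) L / card (C S) else 0) + (1 - q S) * ?R) =
     (\<lambda>S. (if t = 1 then indicator (C S) L / B else 0) + ?R - ?R / B * card (C S))"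
  proof
    fix S
    \<comment> \<open>The number \<open>d\<close> of completions cancels between acceptance and
      selection, so the mass no longer depends on \<open>S\<close>. If \<open>d = 0\<close>, both
      sides are 0.\<close>
    have *: "q S * (indicator (C S) L / card (C S)) = indicator (C S) L / B"
      using finite_completions[of n "S(1 := id)"] by (auto simp: q_def C_def indicator_def)
    have "(1 - q S) * ?R = ?R - ?R / B * card (C S)"
      by (simp add: q_def left_diff_distrib)
    moreover have "q S * (if t = 1 then indicator (C S) L / card (C S) else 0) =
        (if t = 1 then indicator (C S) L / B else 0)"
      unfolding *[symmetric] by simp
    ultimately show "q S * (if t = 1 then indicator (C S) L / card (C S) else 0) + (1 - q S) * ?R =
      (if t = 1 then indicator (C S) L / B else 0) + ?R - ?R / B * card (C S)"
      by linarith
  qed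
  also have "(\<Sum>S\<in>?\<Omega>. (if t = 1 then indicator (C S) L / B else 0) + ?R - ?R / B * card (C S)) =
     (if t = 1 then (\<Sum>S\<in>?\<Omega>. indicator (C S) L) / B else 0) + card ?\<Omega> * ?R - ?R / B * (\<Sum>S\<in>?\<Omega>. real (card (C S)))"
    by (simp add: sum.distrib sum_subtractf sum_distrib_left sum_divide_distrib)
  also have "(\<Sum>S\<in>?\<Omega>. real (card (C S))) = card ?N"
    unfolding C_def using sum_card_completions[of n] n by (simp flip: of_nat_sum)
  \<comment> \<open>\<open>L\<close> completes exactly one row choice if it is normalized, and none
    otherwise.\<close>
  also have "(\<Sum>S\<in>?\<Omega>. indicator (C S) L) = (indicator ?N L :: real)"
  proof (cases "L \<in> ?N")
    case True
    have "(\<Sum>S\<in>?\<Omega>. indicator (C S) L :: real) = real (card {S \<in> ?\<Omega>. L \<in> C S})"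
      using finite_row_choices by (simp add: indicator_def of_bool_def sum.If_cases Int_def)
    also have "{S \<in> ?\<Omega>. L \<in> C S} = {\<lambda>i. if i \<in> {2..n-3} then L i else undefined}"
      unfolding C_def using True n by (intro completions_unique) simp_all
    finally show ?thesis using True by simp
  next
    case False
    then have "L \<notin> C S" for S using completions_normalized[of n S] n by (auto simp: C_def)
    then show ?thesis using False by simp
  qed
  also have "((if t = 1 then indicator ?N L / B else 0) + card ?\<Omega> * ?R - ?R / B * card ?N) / card ?\<Omega> =
     (if t = 1 then indicator ?N L / (B * card ?\<Omega>) else 0) + (1 - card ?N / (B * card ?\<Omega>)) * ?R"
    using c\<Omega> B by (simp add: field_simps)
  also have "card ?N / (B * card ?\<Omega>) = acceptance_prob n"
    by (simp add: acceptance_prob_def B_def card_row_choices)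
  also have "indicator ?N L / (B * card ?\<Omega>) = acceptance_prob n * pmf (pmf_of_set ?N) L"
    using normalized_squares_nonempty[of n] n
    by (simp add: acceptance_prob_def B_def card_row_choices finite_normalized_squares)
  finally show ?thesis .
qed

text \<open>Every ratio \<open>d / B\<close> is at most 1, hence so is the mean; positivity comes
  from the existence of a normalized square.\<close>

lemma acceptance_prob_bounds:
  assumes n: "n \<ge> 5"
  shows "0 < acceptance_prob n" "acceptance_prob n \<le> 1"
proof -
  let ?c = "real (card (row_choices n))" and ?B = "real_of_int (completion_bound n)"
  have B: "0 < ?B" using completion_bound_pos by simp
  have c: "0 < ?c" using n row_choices_nonempty[of n] by (simp add: card_gt_0_iff finite_row_choices)
  have N: "0 < card (normalized_squares n)"
    using n normalized_squares_nonempty[of n] finite_normalized_squares by (simp add: card_gt_0_iff)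
  have p: "acceptance_prob n = real (card (normalized_squares n)) / (?B * ?c)"
    by (simp add: acceptance_prob_def card_row_choices)
  show "0 < acceptance_prob n" unfolding p using N B c by simp
  have "real (card (normalized_squares n)) = (\<Sum>S\<in>row_choices n. real (card (completions n (S(1 := id)))))"
    using sum_card_completions[of n] n by (simp flip: of_nat_sum)
  also have "\<dots> \<le> (\<Sum>S\<in>row_choices n. ?B)"
  proof (rule sum_mono)
    fix S
    have "int (card (completions n (S(1 := id)))) \<le> completion_bound n"
      using n by (intro card_completions_le) simp
    then show "real (card (completions n (S(1 := id)))) \<le> ?B" by linarith
  qed
  finally show "acceptance_prob n \<le> 1"
    unfolding p using B c by (simp add: mult.commute)
qed

text \<open>The one-round equation expresses the mass at \<open>t\<close> by that at
  \<open>t - 1\<close> and gives 0 at \<open>t = 0\<close>, so induction on \<open>t\<close>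
  determines all masses. They sum to 1, so the loop terminates almost surely.\<close>

lemma pdc_loop_eq:
  assumes n: "n \<ge> 5"
  shows "pdc_loop n = spmf_of_pmf
    (pair_pmf (geometric_trials_pmf (acceptance_prob n)) (pmf_of_set (normalized_squares n)))"
proof (rule spmf_eqI, clarify)
  fix t L
  let ?p = "acceptance_prob n"
  \<comment> \<open>Trials are counted from 1, so count \<open>t\<close> means \<open>t - 1\<close>
    failures.\<close>
  have geo: "pmf (geometric_trials_pmf ?p) t = (if t = 0 then 0 else (1 - ?p) ^ (t - 1) * ?p)" for t
  proof (cases t)
    case 0
    then show ?thesis by (auto simp: geometric_trials_pmf_def pmf_map_outside)
  next
    case (Suc k)
    then show ?thesis using acceptance_prob_bounds[OF n]
      by (simp add: geometric_trials_pmf_def pmf_map_inj')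
  qed
  have "spmf (pdc_loop n) (t, L) =
    (if t = 0 then 0 else (1 - ?p) ^ (t - 1) * ?p) * pmf (pmf_of_set (normalized_squares n)) L"
  proof (induction t)
    case 0
    show ?case by (subst spmf_pdc_loop_step[OF n]) simp
  next
    case (Suc t)
    have "spmf (pdc_loop n) (Suc t, L) =
      (if t = 0 then ?p * pmf (pmf_of_set (normalized_squares n)) L else 0)
      + (1 - ?p) * spmf (pdc_loop n) (t, L)"
      by (subst spmf_pdc_loop_step[OF n]) simp
    then show ?case unfolding Suc.IH by (cases t) simp_all
  qed
  then show "spmf (pdc_loop n) (t, L) = spmf (spmf_of_pmf
    (pair_pmf (geometric_trials_pmf ?p) (pmf_of_set (normalized_squares n)))) (t, L)"
    by (simp add: pmf_pair geo)
qed

section \<open>The output of the whole algorithm\<close>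

lemma pair_pmf_of_set:
  assumes "finite A" "A \<noteq> {}" "finite B" "B \<noteq> {}"
  shows "pair_pmf (pmf_of_set A) (pmf_of_set B) = pmf_of_set (A \<times> B)"
proof (rule pmf_eqI)
  fix x show "pmf (pair_pmf (pmf_of_set A) (pmf_of_set B)) x = pmf (pmf_of_set (A \<times> B)) x"
    using assms by (cases x) (simp add: pmf_pair card_cartesian_product indicator_times)
qed

text \<open>Once the loop is known to lose no mass, the whole program is a \<open>pmf\<close>, where
  independent draws can be reordered.\<close>

lemma pdc_sampling_eq:
  fixes n :: nat
  assumes n: "n \<ge> 5"
  defines "Q \<equiv> pmf_of_set {\<pi>. \<pi> permutes {1..n}}"
  shows "pdc_sampling n = spmf_of_pmf (do {
     (t, L) \<leftarrow> pair_pmf (geometric_trials_pmf (acceptance_prob n)) (pmf_of_set (normalized_squares n));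
     \<rho> \<leftarrow> Q;
     \<sigma> \<leftarrow> Q;
     return_pmf (t, relabel n \<rho> \<sigma> L)})"
proof -
  have "finite {\<pi>. \<pi> permutes {1..n}}" "{\<pi>. \<pi> permutes {1..n}} \<noteq> {}"
    using finite_permutations[of "{1..n}"] permutes_id[of "{1..n}"] by blast+
  then have "spmf_of_set {\<pi>. \<pi> permutes {1..n}} = spmf_of_pmf Q"
    by (simp add: Q_def)
  then show ?thesis
    unfolding pdc_sampling_def pdc_loop_eq[OF n] relabel_def
    by (simp add: spmf_of_pmf_bind case_prod_beta')
qed

lemma fst_pdc_sampling:
  assumes "n \<ge> 5"
  shows "map_spmf fst (pdc_sampling n) = spmf_of_pmf (geometric_trials_pmf (acceptance_prob n))"
  unfolding pdc_sampling_eq[OF assms]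
  by (simp add: map_bind_pmf case_prod_beta' map_fst_pair_pmf pmf.map_comp o_def flip: map_pmf_def)

text \<open>For every fixed \<open>\<rho>\<close>, a uniform normalized square and an independent
  uniform \<open>\<sigma>\<close> already yield a uniform Latin square by
  \<open>bij_betw_relabel\<close>, so averaging over \<open>\<rho>\<close> changes nothing.\<close>

lemma snd_pdc_sampling:
  assumes n: "n \<ge> 5"
  shows "map_spmf snd (pdc_sampling n) = spmf_of_pmf (pmf_of_set (latin_squares n))"
proof -
  let ?P = "{\<pi>. \<pi> permutes {1..n}}" and ?N = "normalized_squares n"
  let ?G = "geometric_trials_pmf (acceptance_prob n)"
  have P: "finite ?P" "?P \<noteq> {}" using finite_permutations[of "{1..n}"] permutes_id[of "{1..n}"] by blast+
  have N: "finite ?N" "?N \<noteq> {}" using n by (simp_all add: finite_normalized_squares normalized_squares_nonempty)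
  have uniform: "map_pmf (\<lambda>(L, \<sigma>). relabel n \<rho> \<sigma> L) (pair_pmf (pmf_of_set ?N) (pmf_of_set ?P)) =
      pmf_of_set (latin_squares n)" if "\<rho> \<in> ?P" for \<rho>
    unfolding pair_pmf_of_set[OF N P]
    using that n P N by (intro map_pmf_of_set_bij_betw bij_betw_relabel) auto
  have "map_spmf snd (pdc_sampling n) = spmf_of_pmf (bind_pmf (pmf_of_set ?N) (\<lambda>L.
      bind_pmf (pmf_of_set ?P) (\<lambda>\<rho>. bind_pmf (pmf_of_set ?P) (\<lambda>\<sigma>. return_pmf (relabel n \<rho> \<sigma> L)))))"
    unfolding pdc_sampling_eq[OF n]
    by (simp add: map_bind_pmf case_prod_beta' pair_pmf_def bind_assoc_pmf bind_return_pmf)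
  \<comment> \<open>The draw of \<open>\<rho>\<close> moves in front of that of \<open>L\<close>, so
    that the inner distribution has \<open>\<rho>\<close> fixed.\<close>
  also have "\<dots> = spmf_of_pmf (bind_pmf (pmf_of_set ?P) (\<lambda>\<rho>.
      map_pmf (\<lambda>(L, \<sigma>). relabel n \<rho> \<sigma> L) (pair_pmf (pmf_of_set ?N) (pmf_of_set ?P))))"
    by (subst bind_commute_pmf) (simp add: map_pmf_def pair_pmf_def bind_assoc_pmf bind_return_pmf)
  also have "bind_pmf (pmf_of_set ?P) (\<lambda>\<rho>.
      map_pmf (\<lambda>(L, \<sigma>). relabel n \<rho> \<sigma> L) (pair_pmf (pmf_of_set ?N) (pmf_of_set ?P))) =
    bind_pmf (pmf_of_set ?P) (\<lambda>_. pmf_of_set (latin_squares n))"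
    using uniform P by (intro bind_pmf_cong refl) simp
  finally show ?thesis by simp
qed

text \<open>The mean number of failures is \<open>(1 - p) / p\<close>, and the shift to trials adds
  1. \<open>has_bochner_integral\<close> includes integrability, so the mean is not a default
  value.\<close>

lemma has_bochner_integral_geometric_trials:
  assumes p: "0 < p" "p \<le> 1"
  shows "has_bochner_integral (measure_pmf (geometric_trials_pmf p)) real (1 / p)"
proof -
  have pI: "p \<in> {0<..1}" using p by simp
  have int: "integrable (geometric_pmf p) real"
    by (rule integrable_real_geometric_pmf[OF pI])
  then have "has_bochner_integral (geometric_pmf p) (\<lambda>k. 1 + real k) (1 + (1 - p) / p)"
    unfolding expectation_geometric_pmf[OF pI, symmetric]
    by (intro has_bochner_integral_add has_bochner_integral_integrable) (simp add: has_bochner_integral_iff)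
  moreover have "1 + (1 - p) / p = 1 / p" using p by (simp add: field_simps)
  ultimately show ?thesis
    unfolding geometric_trials_pmf_def has_bochner_integral_iff by simp
qed

theorem theorem5p4:
  fixes n :: nat
  assumes "n \<ge> 5"
  shows "map_spmf snd (pdc_sampling n) = spmf_of_pmf (pmf_of_set (latin_squares n)) \<and>
    (\<exists>p. 0 < p \<and> p \<le> 1 \<and>
       map_spmf fst (pdc_sampling n) = spmf_of_pmf (geometric_trials_pmf p)) \<and>
    has_bochner_integral (measure_spmf (map_spmf fst (pdc_sampling n))) real
      (real_of_int \<lfloor>6 powr (real n / 3) * 2 powr (real n / 2)\<rfloor>
         * real_of_int (round (fact n / exp 1 :: real)) ^ (n - 4)
       / (real (card (latin_squares n)) / fact n))"
proof (intro conjI exI)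
  note p = acceptance_prob_bounds[OF assms]
  show "0 < acceptance_prob n" "acceptance_prob n \<le> 1" by (fact p)+
  show "map_spmf snd (pdc_sampling n) = spmf_of_pmf (pmf_of_set (latin_squares n))"
    by (rule snd_pdc_sampling[OF assms])
  show fst: "map_spmf fst (pdc_sampling n) = spmf_of_pmf (geometric_trials_pmf (acceptance_prob n))"
    by (rule fst_pdc_sampling[OF assms])
  \<comment> \<open>The number of normalized squares becomes
    \<open>card (latin_squares n) / n!\<close>, and the number of derangements becomes the integer
    closest to \<open>n! / e\<close>.\<close>
  have "1 / acceptance_prob n =
    real_of_int \<lfloor>6 powr (real n / 3) * 2 powr (real n / 2)\<rfloor>
         * real_of_int (round (fact n / exp 1 :: real)) ^ (n - 4)
       / (real (card (latin_squares n)) / fact n)"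
    using card_latin_squares[of n] assms
    by (simp add: acceptance_prob_def completion_bound_def card_derangements)
  then show "has_bochner_integral (measure_spmf (map_spmf fst (pdc_sampling n))) real
      (real_of_int \<lfloor>6 powr (real n / 3) * 2 powr (real n / 2)\<rfloor>
         * real_of_int (round (fact n / exp 1 :: real)) ^ (n - 4)
       / (real (card (latin_squares n)) / fact n))"
    unfolding fst measure_spmf_spmf_of_pmf
    using has_bochner_integral_geometric_trials[OF p] by metis
qed

end
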